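(* Let $F$ be the isoperimetric quotient of three-dimensional lattices as a function of the six Selling parameters $(a,b,c,d,e,f)$, and let $\boldsymbol{\rho}_{\mathrm{SC}}=(1,1,1,0,0,0)$. Then: 1. $\boldsymbol{\rho}_{\mathrm{SC}}$ is not a stationary point of $F$ in $\mathbb{R}_{\ge 0}^6$. 2. On the boundary stratum $\Sigma_{\mathrm{box}}=\{\boldsymbol{\rho}=(a,b,c,d,e,f)\in\mathbb{R}_{\ge 0}^6:\ d=e=f=0\}$, which corresponds to orthogonal lattices (rectangular boxes), $\boldsymbol{\rho}_{\mathrm{SC}}$ is a strict local minimiser of $F$ at fixed volume, i.e. it is a strict local minimiser of the restriction of $F$ to $\{\boldsymbol{\rho}\in\Sigma_{\mathrm{box}}:\ \det A(\boldsymbol{\rho})=\det A(\boldsymbol{\rho}_{\mathrm{SC}})\}$.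
   Context: For $\boldsymbol{\rho}=(\rho_{01},\rho_{02},\rho_{03},\rho_{12},\rho_{13},\rho_{23})=(a,b,c,d,e,f)\in\mathbb{R}_{\ge 0}^6$ (Selling parameters) put $$A(\boldsymbol{\rho})=\begin{pmatrix} a+d+e & -d & -e\\ -d & b+d+f & -f\\ -e & -f & c+e+f\end{pmatrix}.$$ When $\det A(\boldsymbol{\rho})>0$, $A(\boldsymbol{\rho})$ is the Gram matrix of a basis $(b_1,b_2,b_3)$ of a lattice $\Lambda\subset\mathbb{R}^3$ with $\rho_{ij}=-\langle b_i,b_j\rangle$ for $0\le i<j\le 3$, where $b_0=-b_1-b_2-b_3$. The function $F$ is defined for $\boldsymbol{\rho}\in\mathbb{R}_{\ge0}^6$ with $\det A(\boldsymbol{\rho})>0$ by $F(\boldsymbol{\rho})=A_T(\boldsymbol{\rho})/(\det A(\boldsymbol{\rho}))^{1/3}$, where $A_T(\boldsymbol{\rho})$ is the surface area of the Voronoi cell of $\Lambda$ (whose volume is $\sqrt{\det A(\boldsymbol{\rho})}$). Explicitly, $$ \begin{aligned} F(a,b,c,d,e,f)=\frac{2}{(\det A)^{5/6}}\Big(& a f \sqrt{b+c+d+e} + b e \sqrt{a+c+d+f} + c d \sqrt{a+b+e+f} \\ &+ \sqrt{a+b+c}\,(de+df+ef) + \sqrt{a+d+e}\,(bc+bf+cf) \\ &+ \sqrt{b+d+f}\,(ac+ae+ce) + \sqrt{c+e+f}\,(ab+ad+bd)\Big). \end{aligned} $$ A point of $\mathbb{R}_{\ge 0}^6$ is stationary for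 $F$ if all six partial derivatives of $F$ vanish there (one-sided derivatives in the coordinates equal to $0$; equivalently, derivatives of the explicit formula, which is smooth in a neighbourhood of $\boldsymbol{\rho}_{\mathrm{SC}}$ in $\mathbb{R}^6$). The point $\boldsymbol{\rho}_{\mathrm{SC}}$ corresponds to the simple cubic lattice, whose Voronoi cell is a cube. *)

theory Defs
  imports "HOL-Analysis.Analysis"
begin

text \<open>Lattices in three-space. A basis is given by the rows of a matrix.\<close>

definition gram :: "real^3^3 \<Rightarrow> real^3^3" where
  "gram b = (\<chi> i j. b $ i \<bullet> b $ j)"

definition lattice_of :: "real^3^3 \<Rightarrow> (real^3) set" where
  "lattice_of b = {(\<Sum>i\<in>UNIV. of_int (k i) *\<^sub>R b $ i) | k :: 3 \<Rightarrow> int. True}"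

definition voronoi_cell :: "(real^3) set \<Rightarrow> (real^3) set" where
  "voronoi_cell L = {x. \<forall>v\<in>L. dist x 0 \<le> dist x v}"

text \<open>
  The area of a planar set in three-space is its two-dimensional Lebesgue measure in an orthonormal
  coordinate system of a plane containing it; the value does not depend on the coordinate system.
  It is only meaningful for sets that lie in a plane.
\<close>

definition plane_chart :: "real^3 \<Rightarrow> real^3 \<Rightarrow> real^3 \<Rightarrow> real^2 \<Rightarrow> real^3" where
  "plane_chart p u w x = p + (x $ 1) *\<^sub>R u + (x $ 2) *\<^sub>R w"

definition is_plane_chart_for :: "(real^3) set \<Rightarrow> (real^2 \<Rightarrow> real^3) \<Rightarrow> bool" where
  "is_plane_chart_for S g \<longleftrightarrow>
     (\<exists>p u w. norm u = 1 \<and> norm w = 1 \<and> u \<bullet> w = 0 \<and> g = plane_chart p u w) \<and> S \<subseteq> range g"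

definition planar_area :: "(real^3) set \<Rightarrow> real" where
  "planar_area S = measure lebesgue ((SOME g. is_plane_chart_for S g) -` S)"

text \<open>Surface area of a three-dimensional convex polytope: the total area of its facets.\<close>

definition surface_area :: "(real^3) set \<Rightarrow> real" where
  "surface_area K = (\<Sum>S | S facet_of K. planar_area S)"

text \<open>
  Selling parameters are vectors
  \<open>\<rho> = (\<rho>\<^sub>0\<^sub>1, \<rho>\<^sub>0\<^sub>2, \<rho>\<^sub>0\<^sub>3, \<rho>\<^sub>1\<^sub>2, \<rho>\<^sub>1\<^sub>3, \<rho>\<^sub>2\<^sub>3) = (a, b, c, d, e, f)\<close>, indexed from 1 to 6.
\<close>

definition orthant :: "(real^6) set" where
  "orthant = {\<rho>. \<forall>i. 0 \<le> \<rho> $ i}"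

definition selling_matrix :: "real^6 \<Rightarrow> real^3^3" where
  "selling_matrix \<rho> =
     (let a = \<rho> $ 1; b = \<rho> $ 2; c = \<rho> $ 3; d = \<rho> $ 4; e = \<rho> $ 5; f = \<rho> $ 6 in
      vector [vector [a + d + e, - d, - e],
              vector [- d, b + d + f, - f],
              vector [- e, - f, c + e + f]])"

lemma selling_parameters_of_gram:
  assumes "gram b = selling_matrix \<rho>"
  defines "b0 \<equiv> - b $ 1 - b $ 2 - b $ 3"
  shows "\<rho> $ 1 = - (b0 \<bullet> b $ 1)" "\<rho> $ 2 = - (b0 \<bullet> b $ 2)" "\<rho> $ 3 = - (b0 \<bullet> b $ 3)"
    and "\<rho> $ 4 = - (b $ 1 \<bullet> b $ 2)" "\<rho> $ 5 = - (b $ 1 \<bullet> b $ 3)" "\<rho> $ 6 = - (b $ 2 \<bullet> b $ 3)"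
proof -
  have g: "b $ i \<bullet> b $ j = selling_matrix \<rho> $ i $ j" for i j
    unfolding assms(1)[symmetric] by (simp add: gram_def)
  show "\<rho> $ 1 = - (b0 \<bullet> b $ 1)" "\<rho> $ 2 = - (b0 \<bullet> b $ 2)" "\<rho> $ 3 = - (b0 \<bullet> b $ 3)"
    "\<rho> $ 4 = - (b $ 1 \<bullet> b $ 2)" "\<rho> $ 5 = - (b $ 1 \<bullet> b $ 3)" "\<rho> $ 6 = - (b $ 2 \<bullet> b $ 3)"
    unfolding b0_def by (simp_all add: inner_diff_left g selling_matrix_def Let_def vector_3)
qed

text \<open>
  The lattice is determined by its Gram matrix up to isometry only, and a representative is chosen;
  such a basis exists whenever \<open>\<rho>\<close> is in the orthant and \<open>det (selling_matrix \<rho>) > 0\<close>.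
\<close>

definition selling_basis :: "real^6 \<Rightarrow> real^3^3" where
  "selling_basis \<rho> = (SOME b. gram b = selling_matrix \<rho>)"

definition cell_area :: "real^6 \<Rightarrow> real" where
  "cell_area \<rho> = surface_area (voronoi_cell (lattice_of (selling_basis \<rho>)))"

text \<open>Only meaningful for \<open>\<rho>\<close> in the orthant with \<open>det (selling_matrix \<rho>) > 0\<close>.\<close>

definition isoperimetric_quotient :: "real^6 \<Rightarrow> real" where
  "isoperimetric_quotient \<rho> = cell_area \<rho> / det (selling_matrix \<rho>) powr (1 / 3)"

text \<open>
  All partial derivatives relative to the orthant vanish; the derivative in a coordinate is
  two-sided where that coordinate is positive and one-sided where it is zero.
\<close>

definition stationary_on_orthant :: "(real^6 \<Rightarrow> real) \<Rightarrow> real^6 \<Rightarrow> bool" where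
  "stationary_on_orthant G \<rho> \<longleftrightarrow>
     (\<forall>i. ((\<lambda>t. G (\<chi> j. if j = i then t else \<rho> $ j)) has_real_derivative 0)
            (at (\<rho> $ i) within {0..}))"

definition strict_local_minimiser_on :: "('a::metric_space \<Rightarrow> real) \<Rightarrow> 'a set \<Rightarrow> 'a \<Rightarrow> bool" where
  "strict_local_minimiser_on G S x \<longleftrightarrow>
     x \<in> S \<and> (\<exists>\<epsilon>>0. \<forall>y\<in>S. y \<noteq> x \<and> dist y x < \<epsilon> \<longrightarrow> G x < G y)"

definition rho_SC :: "real^6" where
  "rho_SC = (\<chi> i. if i \<in> {1, 2, 3} then 1 else 0)"

definition Sigma_box :: "(real^6) set" where
  "Sigma_box = {\<rho> \<in> orthant. \<rho> $ 4 = 0 \<and> \<rho> $ 5 = 0 \<and> \<rho> $ 6 = 0}"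

lemma rho_SC_nth:
  "rho_SC $ 1 = 1" "rho_SC $ 2 = 1" "rho_SC $ 3 = 1"
  "rho_SC $ 4 = 0" "rho_SC $ 5 = 0" "rho_SC $ 6 = 0"
  by (simp_all add: rho_SC_def)

end

(*
  The cell of an orthogonal lattice with edge lengths l, m, h is a box of surface area
  2 (l m + m h + h l). If l m h = 1, this is a sum of three positive numbers with product 1, which
  exceeds 3 unless all of them are 1; hence the cube is the strict minimiser among boxes.

  The quotient decreases in the direction d. For (1, 1, 1, t, 0, 0) the cell is the prism of height 1
  over the hexagonal cell of a planar lattice with superbase of squared lengths 2, 1 + t, 1 + t and
  determinant D = 1 + 2 t. The lateral facet of a superbase vector x has area p |x| / sqrt D, where p is
  the Selling parameter of the other two vectors. Each base lies in a parallelogram of area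
  (1 + t)^2 / sqrt D, which differs from its true area sqrt D only by terms of order t^2. Comparing
  with the value 6 at t = 0, the resulting upper bound has derivative 2 sqrt 2 - 4 < 0.
*)

theory Submission
  imports Defs
begin

subsection \<open>Areas of planar sets\<close>

lemma dist_plane_chart:
  assumes "norm u = 1" "norm w = 1" "u \<bullet> w = 0"
  shows "dist (plane_chart p u w x) (plane_chart p u w y) = dist x y"
proof -
  have "u \<bullet> u = 1" "w \<bullet> w = 1" "w \<bullet> u = 0"
    using assms by (auto simp: norm_eq_1 inner_commute)
  then have "norm (c *\<^sub>R u + d *\<^sub>R w) = sqrt (c\<^sup>2 + d\<^sup>2)" for c d
    using assms(3) by (simp add: norm_eq_sqrt_inner inner_add_left inner_add_right power2_eq_square)
  moreover have "plane_chart p u w x - plane_chart p u w y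
      = (x $ 1 - y $ 1) *\<^sub>R u + (x $ 2 - y $ 2) *\<^sub>R w"
    by (simp add: plane_chart_def algebra_simps)
  ultimately show ?thesis
    by (simp add: dist_norm norm_eq_sqrt_inner inner_vec_def sum_2 power2_eq_square)
qed

lemma inj_plane_chart:
  assumes "norm u = 1" "norm w = 1" "u \<bullet> w = 0"
  shows "inj (plane_chart p u w)"
  by (metis assms dist_eq_0_iff dist_plane_chart injI)

text \<open>Separates the base point from the linear part, so that facts on linear maps and
  translations apply.\<close>

lemma plane_chart_eq_translation:
  "plane_chart p u w ` S = (+) p ` plane_chart 0 u w ` S"
  by (auto simp: plane_chart_def image_image add.assoc)

lemma linear_plane_chart: "linear (plane_chart 0 u w)"
  by (rule linearI) (simp_all add: plane_chart_def algebra_simps)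

lemma continuous_on_plane_chart: "continuous_on S (plane_chart p u w)"
  unfolding plane_chart_def by (intro continuous_intros)

lemma aff_dim_plane_chart_image:
  assumes "norm u = 1" "norm w = 1" "u \<bullet> w = 0"
  shows "aff_dim (plane_chart p u w ` S) = aff_dim S"
  unfolding plane_chart_eq_translation[of p] aff_dim_translation_eq
  by (rule aff_dim_injective_linear_image[OF linear_plane_chart inj_plane_chart[OF assms]])

lemma affine_range_plane_chart: "affine (range (plane_chart p u w))"
proof -
  have "subspace (range (plane_chart 0 u w))"
    by (intro linear_subspace_image linear_plane_chart subspace_UNIV)
  then show ?thesis
    unfolding plane_chart_eq_translation[of p]
    by (rule affine_translation[THEN iffD1, OF subspace_imp_affine])
qed

text \<open>Both sides are planes and one contains the other. The plane of a chart is thus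
  determined by the set, so any two charts covering \<open>S\<close> have the same range.\<close>

lemma range_plane_chart_eq_affine_hull:
  assumes "norm u = 1" "norm w = 1" "u \<bullet> w = 0"
    and "S \<subseteq> range (plane_chart p u w)" "aff_dim S = 2"
  shows "range (plane_chart p u w) = affine hull S"
proof -
  have "aff_dim (range (plane_chart p u w)) = 2"
    by (simp add: aff_dim_plane_chart_image[OF assms(1-3)] aff_dim_UNIV)
  moreover have "affine hull S \<subseteq> range (plane_chart p u w)"
    by (intro hull_minimal assms affine_range_plane_chart)
  moreover have "affine hull S \<noteq> {}"
    using assms(5) by auto
  ultimately show ?thesis
    using affine_dim_equal[OF affine_affine_hull affine_range_plane_chart, of S p u w] assms(5) by auto
qed

text \<open>Makes \<open>planar_area\<close> computable: the chart picked by \<open>SOME\<close> and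
  the given one parametrise the same plane, so they differ by an isometry of the coordinate plane,
  which preserves Lebesgue measure.\<close>

lemma planar_area_eq:
  assumes "norm u = 1" "norm w = 1" "u \<bullet> w = 0"
    and "S \<subseteq> range (plane_chart p u w)" "aff_dim S = 2"
    and "plane_chart p u w -` S \<in> lmeasurable"
  shows "planar_area S = measure lebesgue (plane_chart p u w -` S)"
proof -
  let ?g = "plane_chart p u w"
  define g' where "g' = (SOME g. is_plane_chart_for S g)"
  have "is_plane_chart_for S ?g"
    unfolding is_plane_chart_for_def using assms(1-4) by (intro conjI exI) simp_all
  then have "is_plane_chart_for S g'"
    unfolding g'_def by (rule someI[of "is_plane_chart_for S"])
  then obtain p' u' w' where g': "g' = plane_chart p' u' w'" "S \<subseteq> range g'"
    and on: "norm u' = 1" "norm w' = 1" "u' \<bullet> w' = 0"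
    unfolding is_plane_chart_for_def by (elim conjE exE)
  have "range ?g = range g'"
    using range_plane_chart_eq_affine_hull[OF assms(1-5)]
      range_plane_chart_eq_affine_hull[OF on _ assms(5), of p'] g' by simp
  then have "\<forall>x. \<exists>y. g' y = ?g x"
    by (metis rangeI rangeE)
  \<comment> \<open>\<open>h\<close> is the change of coordinates from the given chart to the chosen
    one.\<close>
  then obtain h where h: "\<And>x. g' (h x) = ?g x"
    by metis
  have "dist (h x) (h y) = dist x y" for x y
    using dist_plane_chart[OF on, of p' "h x" "h y"] dist_plane_chart[OF assms(1-3), of p x y]
    unfolding g'(1)[symmetric] h by simp
  \<comment> \<open>An isometry that fixes the origin is orthogonal; subtracting \<open>h 0\<close>
    splits \<open>h\<close> into such a map and a translation.\<close>
  then have orth: "orthogonal_transformation (\<lambda>x. h x - h 0)"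
    by (simp add: orthogonal_transformation_isometry dist_norm)
  have "g' -` S = h ` (?g -` S)"
  proof (intro equalityI subsetI)
    fix z assume "z \<in> g' -` S"
    then obtain y where "g' z = ?g y" "g' z \<in> S"
      using assms(4) by blast
    then have "h y = z"
      using h inj_plane_chart[OF on, of p'] g' by (metis injD)
    then show "z \<in> h ` (?g -` S)"
      using \<open>g' z = ?g y\<close> \<open>g' z \<in> S\<close> by auto
  qed (auto simp: h)
  also have "\<dots> = (+) (h 0) ` (\<lambda>x. h x - h 0) ` (?g -` S)"
    by (simp add: image_image)
  finally show ?thesis
    unfolding planar_area_def g'_def[symmetric]
    by (simp only: measure_translation measure_orthogonal_image[OF orth assms(6)])
qed

subsection \<open>Facets of intersections of half-spaces\<close>

lemma halfspaces_eq_INT: "{x. \<forall>i\<in>I. a i \<bullet> x \<le> b i} = (\<Inter>i\<in>I. {x. a i \<bullet> x \<le> b i})"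
  by blast

lemma strict_halfspaces_subset_interior:
  fixes a :: "'i \<Rightarrow> 'a::euclidean_space"
  assumes "finite I"
  shows "{x. \<forall>i\<in>I. a i \<bullet> x < b i} \<subseteq> interior {x. \<forall>i\<in>I. a i \<bullet> x \<le> b i}"
proof (rule interior_maximal)
  have "open (\<Inter>i\<in>I. {x. a i \<bullet> x < b i})"
    using assms by (intro open_INT) (auto simp: open_halfspace_lt)
  moreover have "{x. \<forall>i\<in>I. a i \<bullet> x < b i} = (\<Inter>i\<in>I. {x. a i \<bullet> x < b i})"
    by blast
  ultimately show "open {x. \<forall>i\<in>I. a i \<bullet> x < b i}"
    by simp
qed (auto intro: less_imp_le)

lemma aff_dim_halfspaces:
  fixes a :: "'i \<Rightarrow> 'a::euclidean_space"
  assumes "finite I" "\<And>i. i \<in> I \<Longrightarrow> a i \<bullet> z < b i"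
  shows "aff_dim {x. \<forall>i\<in>I. a i \<bullet> x \<le> b i} = DIM('a)"
proof (rule aff_dim_nonempty_interior)
  have "z \<in> interior {x. \<forall>i\<in>I. a i \<bullet> x \<le> b i}"
    by (rule subsetD[OF strict_halfspaces_subset_interior[OF assms(1)]]) (use assms(2) in blast)
  then show "interior {x. \<forall>i\<in>I. a i \<bullet> x \<le> b i} \<noteq> {}"
    by blast
qed

text \<open>
  The half-spaces need not be irredundant, so this only bounds the set of facets from above.
\<close>

lemma facet_of_halfspaces:
  fixes a :: "'i \<Rightarrow> 'a::euclidean_space"
  assumes "finite I" and K: "K = {x. \<forall>i\<in>I. a i \<bullet> x \<le> b i}"
    and z: "\<And>i. i \<in> I \<Longrightarrow> a i \<bullet> z < b i"
    and S: "S facet_of K"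
  shows "\<exists>i\<in>I. S = K \<inter> {x. a i \<bullet> x = b i}"
proof -
  have face: "S face_of K" and ne: "S \<noteq> {}" and dim: "aff_dim S = aff_dim K - 1"
    using S by (auto simp: facet_of_def)
  have "convex K"
    unfolding K halfspaces_eq_INT by (intro convex_INT convex_halfspace_le)
  obtain y where y: "y \<in> rel_interior S"
    using ne rel_interior_eq_empty face_of_imp_convex[OF face] by blast
  then have "y \<in> S" "y \<in> K"
    using rel_interior_subset face_of_imp_subset[OF face] by blast+
  \<comment> \<open>A relative interior point \<open>y\<close> of the facet is thus on the boundary
    of \<open>K\<close>, so some constraint is tight there.\<close>
  have "S \<inter> interior K = {}"
    using face_of_disjoint_interior[OF face] dim by force
  then obtain i where i: "i \<in> I" "a i \<bullet> y = b i"
    using strict_halfspaces_subset_interior[OF \<open>finite I\<close>, of a b] \<open>y \<in> S\<close> \<open>y \<in> K\<close>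
    unfolding K by force
  \<comment> \<open>The tight constraint cuts out a face \<open>T\<close>. It contains
    \<open>S\<close> because it meets the relative interior of \<open>S\<close>, and it is proper
    because of \<open>z\<close>. As \<open>S\<close> has codimension one, there is no room between
    \<open>S\<close> and \<open>T\<close>.\<close>
  define T where "T = K \<inter> {x. a i \<bullet> x = b i}"
  have T: "T face_of K"
    unfolding T_def using \<open>convex K\<close> i by (intro face_of_Int_supporting_hyperplane_le) (auto simp: K)
  have "S \<subseteq> T"
    by (rule subset_of_face_of[OF T face_of_imp_subset[OF face]])
      (use y i \<open>y \<in> K\<close> in \<open>auto simp: T_def\<close>)
  have "z \<in> K" "z \<notin> T"
    using z[OF i(1)] z by (auto simp: K T_def less_imp_le)
  then have "aff_dim T < aff_dim K"
    using face_of_aff_dim_lt[OF \<open>convex K\<close> T] by blast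
  moreover have "S face_of T"
    using face_of_subset[OF face \<open>S \<subseteq> T\<close>] T by (simp add: face_of_imp_subset)
  ultimately have "S = T"
    using face_of_aff_dim_lt[of T S] face_of_imp_convex[OF T] dim by force
  then show ?thesis
    using i T_def by blast
qed

section \<open>Orthonormal frames and plane sections of compact sets\<close>

definition frame :: "real^3 \<Rightarrow> real^3 \<Rightarrow> real^3 \<Rightarrow> bool" where
  "frame n u w \<longleftrightarrow>
     n \<bullet> n = 1 \<and> u \<bullet> u = 1 \<and> w \<bullet> w = 1 \<and> n \<bullet> u = 0 \<and> n \<bullet> w = 0 \<and> u \<bullet> w = 0"

lemma frame_rotate: "frame n u w \<Longrightarrow> frame u w n"
  by (auto simp: frame_def inner_commute)

lemma frame_uminus: "frame n u w \<Longrightarrow> frame (- n) u w"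
  by (auto simp: frame_def)

text \<open>Three orthogonal nonzero vectors span the space by counting dimensions; the remainder of
  the expansion is orthogonal to the span, hence to itself.\<close>

lemma frame_expansion:
  assumes "frame n u w"
  shows "x = (n \<bullet> x) *\<^sub>R n + (u \<bullet> x) *\<^sub>R u + (w \<bullet> x) *\<^sub>R w"
proof -
  let ?B = "{n, u, w}"
  have ip: "n \<bullet> n = 1" "u \<bullet> u = 1" "w \<bullet> w = 1" "n \<bullet> u = 0" "n \<bullet> w = 0" "u \<bullet> w = 0"
    "u \<bullet> n = 0" "w \<bullet> n = 0" "w \<bullet> u = 0"
    using assms by (auto simp: frame_def inner_commute)
  then have "pairwise orthogonal ?B" "0 \<notin> ?B"
    by (auto simp: pairwise_def orthogonal_def)
  then have "independent ?B"
    by (rule pairwise_orthogonal_independent)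
  moreover
  have "card ?B = 3"
    using ip by (subst card_3_iff) (metis zero_neq_one)
  then have "dim (UNIV :: (real^3) set) \<le> card ?B"
    by simp
  ultimately have "span ?B = UNIV"
    using card_ge_dim_independent[OF subset_UNIV] by blast
  define y where "y = x - ((n \<bullet> x) *\<^sub>R n + (u \<bullet> x) *\<^sub>R u + (w \<bullet> x) *\<^sub>R w)"
  have "orthogonal y b" if "b \<in> ?B" for b
    using that ip by (auto simp: orthogonal_def y_def inner_diff_left inner_add_left inner_commute[of x])
  then have "orthogonal y y"
    using orthogonal_to_span \<open>span ?B = UNIV\<close> by blast
  then show ?thesis
    by (simp add: y_def orthogonal_def)
qed

lemma frame_norm:
  assumes "frame n u w"
  shows "norm n = 1" "norm u = 1" "norm w = 1"
  using assms by (auto simp: frame_def norm_eq_1)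

text \<open>The plane normal to \<open>n\<close> at height \<open>h\<close> is exactly the range of
  the chart based at \<open>h\<close> times \<open>n\<close> with directions \<open>u\<close> and
  \<open>w\<close>.\<close>

lemma frame_section:
  assumes "frame n u w"
  shows "K \<inter> {x. n \<bullet> x = h} = plane_chart (h *\<^sub>R n) u w ` (plane_chart (h *\<^sub>R n) u w -` K)"
proof (intro equalityI subsetI)
  fix x assume x: "x \<in> K \<inter> {x. n \<bullet> x = h}"
  have "x = plane_chart (h *\<^sub>R n) u w (vector [u \<bullet> x, w \<bullet> x])"
    using x frame_expansion[OF assms, of x] by (simp add: plane_chart_def)
  then show "x \<in> plane_chart (h *\<^sub>R n) u w ` (plane_chart (h *\<^sub>R n) u w -` K)"
    using x by (metis (no_types, lifting) IntD1 image_eqI vimageI)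
next
  fix x assume "x \<in> plane_chart (h *\<^sub>R n) u w ` (plane_chart (h *\<^sub>R n) u w -` K)"
  then show "x \<in> K \<inter> {x. n \<bullet> x = h}"
    using assms by (auto simp: plane_chart_def frame_def inner_add_right)
qed

text \<open>Reduces areas of sections to Lebesgue measure in the plane. The chart is an isometry, so
  the preimage of a compact set is closed and bounded, hence measurable.\<close>

lemma planar_area_section:
  assumes "frame n u w" and "compact K" and "aff_dim (K \<inter> {x. n \<bullet> x = h}) = 2"
  shows "plane_chart (h *\<^sub>R n) u w -` K \<in> lmeasurable"
    and "planar_area (K \<inter> {x. n \<bullet> x = h}) = measure lebesgue (plane_chart (h *\<^sub>R n) u w -` K)"
proof -
  let ?g = "plane_chart (h *\<^sub>R n) u w" and ?S = "K \<inter> {x. n \<bullet> x = h}"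
  have on: "norm u = 1" "norm w = 1" "u \<bullet> w = 0"
    using assms(1) frame_norm by (auto simp: frame_def)
  have "closed (?g -` K)"
    using compact_imp_closed[OF assms(2)] continuous_on_plane_chart[of UNIV]
    by (simp add: continuous_closed_vimage continuous_on_eq_continuous_at)
  moreover have "bounded (?g -` K)"
  proof -
    obtain B where B: "\<And>x. x \<in> K \<Longrightarrow> dist (?g 0) x \<le> B"
      using compact_imp_bounded[OF assms(2)] bounded_any_center by metis
    have "dist 0 y \<le> B" if "y \<in> ?g -` K" for y
      using B[of "?g y"] that dist_plane_chart[OF on, of "h *\<^sub>R n" 0 y] by simp
    then show ?thesis
      unfolding bounded_def by blast
  qed
  ultimately show meas: "?g -` K \<in> lmeasurable"
    by (simp add: compact_eq_bounded_closed lmeasurable_compact)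
  have eq: "?S = ?g ` (?g -` K)"
    by (rule frame_section[OF assms(1)])
  have "?g -` ?S = ?g -` K"
    unfolding eq using inj_plane_chart[OF on] by (simp add: inj_vimage_image_eq)
  then show "planar_area ?S = measure lebesgue (?g -` K)"
    using planar_area_eq[OF on, of ?S "h *\<^sub>R n"] assms(3) meas eq by auto
qed

subsection \<open>Rectangular boxes\<close>

text \<open>The numbers \<open>p\<close>, \<open>q\<close>, \<open>r\<close> are half the edge
  lengths.\<close>

definition brick :: "real^3 \<Rightarrow> real^3 \<Rightarrow> real^3 \<Rightarrow> real \<Rightarrow> real \<Rightarrow> real \<Rightarrow> (real^3) set" where
  "brick n u w p q r = {x. \<bar>n \<bullet> x\<bar> \<le> p \<and> \<bar>u \<bullet> x\<bar> \<le> q \<and> \<bar>w \<bullet> x\<bar> \<le> r}"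

lemma brick_rotate: "brick n u w p q r = brick u w n q r p"
  by (auto simp: brick_def)

lemma brick_uminus: "brick (- n) u w p q r = brick n u w p q r"
  by (simp add: brick_def)

lemma brick_eq_halfspaces:
  "brick n u w p q r = {x. \<forall>i \<in> set [(n, p), (- n, p), (u, q), (- u, q), (w, r), (- w, r)].
     fst i \<bullet> x \<le> snd i}"
  by (auto simp: brick_def abs_le_iff)

lemma convex_brick: "convex (brick n u w p q r)"
  unfolding brick_eq_halfspaces halfspaces_eq_INT by (intro convex_INT convex_halfspace_le)

lemma closed_brick: "closed (brick n u w p q r)"
  unfolding brick_eq_halfspaces halfspaces_eq_INT by (intro closed_INT ballI closed_halfspace_le)

lemma bounded_brick:
  assumes "frame n u w"
  shows "bounded (brick n u w p q r)"
  unfolding bounded_iff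
proof (intro exI ballI)
  fix x assume "x \<in> brick n u w p q r"
  then have x: "\<bar>n \<bullet> x\<bar> \<le> p" "\<bar>u \<bullet> x\<bar> \<le> q" "\<bar>w \<bullet> x\<bar> \<le> r"
    by (auto simp: brick_def)
  have "norm x \<le> norm ((n \<bullet> x) *\<^sub>R n) + norm ((u \<bullet> x) *\<^sub>R u) + norm ((w \<bullet> x) *\<^sub>R w)"
    by (subst frame_expansion[OF assms, of x]) (intro norm_triangle_le add_right_mono norm_triangle_ineq)
  also have "\<dots> \<le> p + q + r"
    using x frame_norm[OF assms] by simp
  finally show "norm x \<le> p + q + r" .
qed

lemma compact_brick: "frame n u w \<Longrightarrow> compact (brick n u w p q r)"
  by (simp add: compact_eq_bounded_closed bounded_brick closed_brick)

lemma aff_dim_brick: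
  assumes "p > 0" "q > 0" "r > 0"
  shows "aff_dim (brick n u w p q r) = 3"
proof -
  have "aff_dim (brick n u w p q r) = DIM(real^3)"
    unfolding brick_eq_halfspaces by (rule aff_dim_halfspaces[where z = 0]) (use assms in auto)
  then show ?thesis
    by simp
qed

lemma measure_cbox_vector_2:
  fixes q r :: real
  assumes "q \<ge> 0" "r \<ge> 0"
  shows "measure lebesgue (cbox (vector [- q, - r] :: real^2) (vector [q, r])) = 4 * q * r"
proof -
  have "0 \<in> cbox (vector [- q, - r] :: real^2) (vector [q, r])"
    using assms by (simp add: mem_box_cart forall_2)
  then show ?thesis
    by (subst measure_completion, simp, subst content_cbox_cart) (auto simp: UNIV_2)
qed

text \<open>Only the facet with outer normal \<open>n\<close> is treated; the other five arise by
  rotating the frame and reversing its first vector.\<close>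

lemma brick_facet:
  assumes fr: "frame n u w" and pos: "p > 0" "q > 0" "r > 0"
  shows "(brick n u w p q r \<inter> {x. n \<bullet> x = p}) facet_of brick n u w p q r"
    and "planar_area (brick n u w p q r \<inter> {x. n \<bullet> x = p}) = 4 * q * r"
proof -
  let ?K = "brick n u w p q r"
  let ?g = "plane_chart (p *\<^sub>R n) u w" and ?S = "?K \<inter> {x. n \<bullet> x = p}"
  have vimage: "?g -` ?K = cbox (vector [- q, - r]) (vector [q, r])"
    using fr pos
    by (auto simp: frame_def brick_def plane_chart_def mem_box_cart forall_2 inner_add_right
        inner_commute abs_le_iff)
  have "0 \<in> box (vector [- q, - r] :: real^2) (vector [q, r])"
    using pos by (simp add: mem_box_cart forall_2)
  then have "aff_dim (?g -` ?K) = 2"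
    unfolding vimage by (subst aff_dim_nonempty_interior) (auto simp: interior_cbox)
  then have dim: "aff_dim ?S = 2"
    using fr frame_norm[OF fr] unfolding frame_section[OF fr]
    by (subst aff_dim_plane_chart_image) (auto simp: frame_def)
  show "planar_area ?S = 4 * q * r"
    using planar_area_section(2)[OF fr compact_brick[OF fr] dim] pos measure_cbox_vector_2[of q r]
    unfolding vimage by simp
  have "?S face_of ?K"
    by (intro face_of_Int_supporting_hyperplane_le convex_brick) (auto simp: brick_def)
  moreover have "?S \<noteq> {}"
    using dim by auto
  ultimately show "?S facet_of ?K"
    using dim aff_dim_brick[OF pos] by (simp add: facet_of_def)
qed

text \<open>The six tight constraints give all facets, and they give six different ones, so the sum
  over the set of facets is a sum over a list.\<close>

lemma surface_area_brick:
  assumes fr: "frame n u w" and pos: "p > 0" "q > 0" "r > 0"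
  shows "surface_area (brick n u w p q r) = 8 * (p * q + q * r + r * p)"
proof -
  let ?K = "brick n u w p q r"
  let ?L = "[(n, p), (- n, p), (u, q), (- u, q), (w, r), (- w, r)]"
  define F where "F i = ?K \<inter> {x. fst i \<bullet> x = snd i}" for i
  have ip: "n \<bullet> n = 1" "u \<bullet> u = 1" "w \<bullet> w = 1" "n \<bullet> u = 0" "n \<bullet> w = 0" "u \<bullet> w = 0"
    "u \<bullet> n = 0" "w \<bullet> n = 0" "w \<bullet> u = 0"
    using fr by (auto simp: frame_def inner_commute)
  have fr2: "frame u w n" and fr3: "frame w n u"
    using frame_rotate fr by blast+
  have K2: "?K = brick u w n q r p" and K3: "?K = brick w n u r p q"
    using brick_rotate by metis+
  have facets: "F i facet_of ?K" if "i \<in> set ?L" for i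
    using that brick_facet(1)[OF fr pos] brick_facet(1)[OF frame_uminus[OF fr] pos]
      brick_facet(1)[OF fr2 pos(2,3,1)] brick_facet(1)[OF frame_uminus[OF fr2] pos(2,3,1)]
      brick_facet(1)[OF fr3 pos(3,1,2)] brick_facet(1)[OF frame_uminus[OF fr3] pos(3,1,2)]
    unfolding F_def brick_uminus K2[symmetric] K3[symmetric] by auto
  have area: "map (planar_area \<circ> F) ?L = [4*q*r, 4*q*r, 4*r*p, 4*r*p, 4*p*q, 4*p*q]"
    using brick_facet(2)[OF fr pos] brick_facet(2)[OF frame_uminus[OF fr] pos]
      brick_facet(2)[OF fr2 pos(2,3,1)] brick_facet(2)[OF frame_uminus[OF fr2] pos(2,3,1)]
      brick_facet(2)[OF fr3 pos(3,1,2)] brick_facet(2)[OF frame_uminus[OF fr3] pos(3,1,2)]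
    unfolding F_def brick_uminus K2[symmetric] K3[symmetric] by simp
  have "{S. S facet_of ?K} = F ` set ?L"
  proof (intro equalityI subsetI)
    fix S assume "S \<in> {S. S facet_of ?K}"
    then have "\<exists>i\<in>set ?L. S = F i"
      unfolding F_def using pos
      by (intro facet_of_halfspaces[where z = 0, OF finite_set brick_eq_halfspaces]) auto
    then show "S \<in> F ` set ?L"
      by blast
  qed (use facets in blast)
  moreover have "distinct (map F ?L)"
  proof -
    \<comment> \<open>The coordinates in the frame tell the six normals apart.\<close>
    have "distinct (map (\<lambda>(v, h). (n \<bullet> v, u \<bullet> v, w \<bullet> v)) ?L)"
      by (simp add: ip)
    then have "distinct ?L"
      by (simp only: distinct_map)
    moreover have "inj_on F (set ?L)"
    proof (rule inj_onI)
      fix i j assume ij: "i \<in> set ?L" "j \<in> set ?L" and eq: "F i = F j"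
      \<comment> \<open>This point is the centre of the facet \<open>F i\<close>. If it also lies on
        \<open>F j\<close>, then \<open>fst j\<close> must have positive inner product with
        \<open>fst i\<close>, which among the six normals forces \<open>i = j\<close>.\<close>
      have "snd i *\<^sub>R fst i \<in> F i"
        using ij(1) pos by (auto simp: F_def brick_def ip)
      then have "snd i * (fst j \<bullet> fst i) = snd j"
        unfolding eq by (simp add: F_def)
      then show "i = j"
        using ij pos by (auto simp: ip)
    qed
    ultimately show ?thesis
      by (simp only: distinct_map simp_thms)
  qed
  ultimately have "surface_area ?K = sum_list (map planar_area (map F ?L))"
    by (simp only: surface_area_def sum.distinct_set_conv_list flip: set_map)
  then show ?thesis
    using area by (simp add: algebra_simps)
qed

subsection \<open>Orthogonal lattices\<close>

text \<open>Squaring the distances cancels the quadratic term in \<open>x\<close> and leaves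
  half-spaces.\<close>

lemma mem_voronoi_cell: "x \<in> voronoi_cell L \<longleftrightarrow> (\<forall>v\<in>L. 2 * (v \<bullet> x) \<le> v \<bullet> v)"
proof -
  have "dist x 0 \<le> dist x v \<longleftrightarrow> 2 * (v \<bullet> x) \<le> v \<bullet> v" for v
    using inner_commute[of x v] by (simp add: dist_norm norm_le inner_diff_left inner_diff_right)
  then show ?thesis
    by (simp add: voronoi_cell_def)
qed

lemma lattice_of_eq:
  "lattice_of b = {of_int i *\<^sub>R b $ 1 + of_int j *\<^sub>R b $ 2 + of_int k *\<^sub>R b $ 3 | i j k. True}"
  (is "_ = ?R")
proof (intro equalityI subsetI)
  fix v assume "v \<in> ?R"
  then obtain i j k where v: "v = of_int i *\<^sub>R b $ 1 + of_int j *\<^sub>R b $ 2 + of_int k *\<^sub>R b $ 3"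
    by blast
  define m :: "3 \<Rightarrow> int" where "m = (\<lambda>l. if l = 1 then i else if l = 2 then j else k)"
  have "v = (\<Sum>l\<in>UNIV. of_int (m l) *\<^sub>R b $ l)"
    by (simp add: sum_3 m_def v)
  then show "v \<in> lattice_of b"
    unfolding lattice_of_def by blast
qed (auto simp: lattice_of_def sum_3)

text \<open>Integers satisfy |k| \<le> k^2. Hence the half-spaces of a vector and its negative imply
  those of all its integer multiples.\<close>

lemma of_int_mult_le_square:
  fixes k :: int and y h :: real
  assumes "\<bar>2 * y\<bar> \<le> h"
  shows "2 * (of_int k * y) \<le> (of_int k)\<^sup>2 * h"
proof -
  have "\<bar>k\<bar> \<le> k\<^sup>2"
    by (cases "k = 0") (use mult_left_mono[of 1 "\<bar>k\<bar>" "\<bar>k\<bar>"] in \<open>auto simp: power2_eq_square\<close>)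
  then have k: "\<bar>of_int k :: real\<bar> \<le> (of_int k)\<^sup>2"
    by (metis of_int_abs of_int_le_iff of_int_power)
  have "2 * (of_int k * y) \<le> \<bar>of_int k\<bar> * \<bar>2 * y\<bar>"
    by (metis abs_ge_self abs_mult mult.left_commute)
  also have "\<dots> \<le> (of_int k)\<^sup>2 * h"
    using assms k by (intro mult_mono) auto
  finally show ?thesis .
qed

text \<open>By orthogonality the half-space condition of a lattice vector is the sum of the
  conditions of its three components, each of which follows from those of a basis vector and its
  negative.\<close>

lemma voronoi_cell_orthogonal:
  assumes orth: "b $ 1 \<bullet> b $ 2 = 0" "b $ 1 \<bullet> b $ 3 = 0" "b $ 2 \<bullet> b $ 3 = 0"
    and pos: "l > 0" "m > 0" "h > 0"
    and sq: "b $ 1 \<bullet> b $ 1 = l\<^sup>2" "b $ 2 \<bullet> b $ 2 = m\<^sup>2" "b $ 3 \<bullet> b $ 3 = h\<^sup>2"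
  shows "voronoi_cell (lattice_of b)
    = brick (b $ 1 /\<^sub>R l) (b $ 2 /\<^sub>R m) (b $ 3 /\<^sub>R h) (l / 2) (m / 2) (h / 2)"
proof (intro equalityI subsetI)
  fix x
  have brick: "x \<in> brick (b $ 1 /\<^sub>R l) (b $ 2 /\<^sub>R m) (b $ 3 /\<^sub>R h) (l / 2) (m / 2) (h / 2) \<longleftrightarrow>
    \<bar>2 * (b $ 1 \<bullet> x)\<bar> \<le> l\<^sup>2 \<and> \<bar>2 * (b $ 2 \<bullet> x)\<bar> \<le> m\<^sup>2 \<and> \<bar>2 * (b $ 3 \<bullet> x)\<bar> \<le> h\<^sup>2"
    using pos by (simp add: brick_def abs_mult field_simps power2_eq_square)
  show "x \<in> brick (b $ 1 /\<^sub>R l) (b $ 2 /\<^sub>R m) (b $ 3 /\<^sub>R h) (l / 2) (m / 2) (h / 2)"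
    if x: "x \<in> voronoi_cell (lattice_of b)"
  proof -
    have *: "2 * (v \<bullet> x) \<le> v \<bullet> v"
      if "v = of_int i *\<^sub>R b $ 1 + of_int j *\<^sub>R b $ 2 + of_int k *\<^sub>R b $ 3" for v i j k
      using x that unfolding mem_voronoi_cell lattice_of_eq by blast
    show ?thesis
      using *[of "b $ 1" 1 0 0] *[of "- b $ 1" "-1" 0 0] *[of "b $ 2" 0 1 0] *[of "- b $ 2" 0 "-1" 0]
        *[of "b $ 3" 0 0 1] *[of "- b $ 3" 0 0 "-1"]
      unfolding brick by (simp add: sq abs_le_iff)
  qed
  show "x \<in> voronoi_cell (lattice_of b)"
    if "x \<in> brick (b $ 1 /\<^sub>R l) (b $ 2 /\<^sub>R m) (b $ 3 /\<^sub>R h) (l / 2) (m / 2) (h / 2)"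
    unfolding mem_voronoi_cell lattice_of_eq
  proof clarify
    fix i j k :: int
    let ?v = "of_int i *\<^sub>R b $ 1 + of_int j *\<^sub>R b $ 2 + of_int k *\<^sub>R b $ 3"
    have "?v \<bullet> ?v = (of_int i)\<^sup>2 * l\<^sup>2 + (of_int j)\<^sup>2 * m\<^sup>2 + (of_int k)\<^sup>2 * h\<^sup>2"
      using orth sq
      by (simp add: inner_add_left inner_add_right inner_commute power2_eq_square algebra_simps)
    moreover have "2 * (of_int i * (b $ 1 \<bullet> x)) \<le> (of_int i)\<^sup>2 * l\<^sup>2"
      "2 * (of_int j * (b $ 2 \<bullet> x)) \<le> (of_int j)\<^sup>2 * m\<^sup>2"
      "2 * (of_int k * (b $ 3 \<bullet> x)) \<le> (of_int k)\<^sup>2 * h\<^sup>2"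
      using that unfolding brick by (intro of_int_mult_le_square; blast)+
    ultimately show "2 * (?v \<bullet> x) \<le> ?v \<bullet> ?v"
      by (simp add: inner_add_left)
  qed
qed

lemma surface_area_orthogonal:
  assumes orth: "b $ 1 \<bullet> b $ 2 = 0" "b $ 1 \<bullet> b $ 3 = 0" "b $ 2 \<bullet> b $ 3 = 0"
    and pos: "l > 0" "m > 0" "h > 0"
    and sq: "b $ 1 \<bullet> b $ 1 = l\<^sup>2" "b $ 2 \<bullet> b $ 2 = m\<^sup>2" "b $ 3 \<bullet> b $ 3 = h\<^sup>2"
  shows "surface_area (voronoi_cell (lattice_of b)) = 2 * (l * m + m * h + h * l)"
proof -
  have "frame (b $ 1 /\<^sub>R l) (b $ 2 /\<^sub>R m) (b $ 3 /\<^sub>R h)"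
    using orth pos by (simp add: frame_def sq power2_eq_square field_simps)
  then show ?thesis
    unfolding voronoi_cell_orthogonal[OF orth pos sq]
    using pos by (subst surface_area_brick) (auto simp: field_simps)
qed

section \<open>Selling parameters of boxes\<close>

lemma forall_6: "(\<forall>i::6. P i) \<longleftrightarrow> P 1 \<and> P 2 \<and> P 3 \<and> P 4 \<and> P 5 \<and> P 6"
proof -
  have "i = 1 \<or> i = 2 \<or> i = 3 \<or> i = 4 \<or> i = 5 \<or> i = 6" for i :: 6
  proof (induct i)
    case (of_int k)
    then have "k = 0 \<or> k = 1 \<or> k = 2 \<or> k = 3 \<or> k = 4 \<or> k = 5"
      by fastforce
    then show ?case
      by auto
  qed
  then show ?thesis
    by metis
qed

text \<open>One explicit basis suffices to know the inner products of the chosen one, and areas are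
  computed below from inner products alone.\<close>

lemma gram_selling_basis:
  assumes "gram b = selling_matrix \<rho>"
  shows "gram (selling_basis \<rho>) = selling_matrix \<rho>"
  unfolding selling_basis_def by (rule someI) (rule assms)

lemma selling_matrix_nth:
  "selling_matrix \<rho> $ 1 $ 1 = \<rho> $ 1 + \<rho> $ 4 + \<rho> $ 5"
  "selling_matrix \<rho> $ 2 $ 2 = \<rho> $ 2 + \<rho> $ 4 + \<rho> $ 6"
  "selling_matrix \<rho> $ 3 $ 3 = \<rho> $ 3 + \<rho> $ 5 + \<rho> $ 6"
  "selling_matrix \<rho> $ 1 $ 2 = - \<rho> $ 4" "selling_matrix \<rho> $ 2 $ 1 = - \<rho> $ 4"
  "selling_matrix \<rho> $ 1 $ 3 = - \<rho> $ 5" "selling_matrix \<rho> $ 3 $ 1 = - \<rho> $ 5"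
  "selling_matrix \<rho> $ 2 $ 3 = - \<rho> $ 6" "selling_matrix \<rho> $ 3 $ 2 = - \<rho> $ 6"
  by (simp_all add: selling_matrix_def Let_def)

lemma gram_nth: "gram b $ i $ j = b $ i \<bullet> b $ j"
  by (simp add: gram_def)

lemma det_selling_matrix_box:
  assumes "\<rho> \<in> Sigma_box"
  shows "det (selling_matrix \<rho>) = \<rho> $ 1 * \<rho> $ 2 * \<rho> $ 3"
  using assms by (simp add: det_3 selling_matrix_nth Sigma_box_def)

lemma cell_area_box:
  assumes box: "\<rho> \<in> Sigma_box" and pos: "\<rho> $ 1 > 0" "\<rho> $ 2 > 0" "\<rho> $ 3 > 0"
  shows "cell_area \<rho> = 2 * (sqrt (\<rho> $ 1) * sqrt (\<rho> $ 2) + sqrt (\<rho> $ 2) * sqrt (\<rho> $ 3)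
    + sqrt (\<rho> $ 3) * sqrt (\<rho> $ 1))"
proof -
  \<comment> \<open>On the box stratum the Selling matrix is diagonal, so its entrywise square root
    is a basis.\<close>
  define b :: "real^3^3" where "b = (\<chi> i j. if i = j then sqrt (selling_matrix \<rho> $ i $ i) else 0)"
  have "gram b = selling_matrix \<rho>"
    using box pos by (simp add: vec_eq_iff forall_3 gram_nth b_def inner_vec_def sum_3
        selling_matrix_nth Sigma_box_def)
  note gram_selling_basis[OF this]
  then have g: "selling_basis \<rho> $ i \<bullet> selling_basis \<rho> $ j = selling_matrix \<rho> $ i $ j" for i j
    by (metis gram_nth)
  show ?thesis
    unfolding cell_area_def using box pos
    by (intro surface_area_orthogonal) (simp_all add: g selling_matrix_nth Sigma_box_def)
qed

section \<open>Strict minimality of the cube among boxes\<close>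

text \<open>The strict inequality of arithmetic and geometric means: sum ln x \<le> x - 1, where
  equality holds only at x = 1; the logarithms add up to zero.\<close>

lemma three_less_sum_of_prod_eq_1:
  fixes x y z :: real
  assumes pos: "x > 0" "y > 0" "z > 0" and prod: "x * y * z = 1"
    and ne: "\<not> (x = 1 \<and> y = 1 \<and> z = 1)"
  shows "3 < x + y + z"
proof -
  have ln: "ln x \<le> x - 1" "ln y \<le> y - 1" "ln z \<le> z - 1"
    using pos by (simp_all add: ln_le_minus_one)
  have "ln x + ln y + ln z = 0"
    using pos prod by (metis ln_mult_pos ln_one mult_pos_pos)
  moreover have "ln x \<noteq> x - 1 \<or> ln y \<noteq> y - 1 \<or> ln z \<noteq> z - 1"
    using pos ne ln_eq_minus_one by blast
  ultimately show ?thesis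
    using ln by linarith
qed

lemma rho_SC_in_Sigma_box: "rho_SC \<in> Sigma_box"
  by (simp add: Sigma_box_def orthant_def rho_SC_def)

lemma det_selling_matrix_rho_SC: "det (selling_matrix rho_SC) = 1"
  by (simp add: det_selling_matrix_box[OF rho_SC_in_Sigma_box] rho_SC_nth)

lemma isoperimetric_quotient_rho_SC: "isoperimetric_quotient rho_SC = 6"
  by (simp add: isoperimetric_quotient_def det_selling_matrix_rho_SC
      cell_area_box[OF rho_SC_in_Sigma_box] rho_SC_nth)

text \<open>The inequality is applied to the three face areas, whose product is the square of the
  volume.\<close>

lemma rho_SC_strict_minimum:
  assumes box: "\<rho> \<in> Sigma_box" and det: "det (selling_matrix \<rho>) = 1" and ne: "\<rho> \<noteq> rho_SC"
  shows "isoperimetric_quotient rho_SC < isoperimetric_quotient \<rho>"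
proof -
  have prod: "\<rho> $ 1 * \<rho> $ 2 * \<rho> $ 3 = 1"
    using det det_selling_matrix_box[OF box] by simp
  have nonneg: "\<rho> $ i \<ge> 0" for i
    using box by (simp add: Sigma_box_def orthant_def)
  then have pos: "\<rho> $ 1 > 0" "\<rho> $ 2 > 0" "\<rho> $ 3 > 0"
    using prod by (auto simp: less_le)
  define l m h where lmh: "l = sqrt (\<rho> $ 1)" "m = sqrt (\<rho> $ 2)" "h = sqrt (\<rho> $ 3)"
  have lmh_pos: "l > 0" "m > 0" "h > 0"
    using pos by (auto simp: lmh)
  have "l * m * h = 1"
    using prod by (simp add: lmh flip: real_sqrt_mult)
  then have "(l * m) * (m * h) * (h * l) = 1"
    by algebra
  moreover have "\<not> (l * m = 1 \<and> m * h = 1 \<and> h * l = 1)"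
  proof
    assume "l * m = 1 \<and> m * h = 1 \<and> h * l = 1"
    then have "l = 1" "m = 1" "h = 1"
      using \<open>l * m * h = 1\<close> by (auto simp: mult.assoc mult.commute)
    then have "\<rho> $ 1 = 1" "\<rho> $ 2 = 1" "\<rho> $ 3 = 1"
      using lmh by (auto simp: real_sqrt_eq_1_iff)
    moreover have "\<rho> $ 4 = 0" "\<rho> $ 5 = 0" "\<rho> $ 6 = 0"
      using box by (auto simp: Sigma_box_def)
    ultimately have "\<rho> = rho_SC"
      by (simp add: vec_eq_iff forall_6 rho_SC_nth)
    with ne show False ..
  qed
  ultimately have "3 < l * m + m * h + h * l"
    using lmh_pos by (intro three_less_sum_of_prod_eq_1) auto
  then show ?thesis
    unfolding isoperimetric_quotient_rho_SC
    by (simp add: isoperimetric_quotient_def det cell_area_box[OF box pos] flip: lmh)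
qed

subsection \<open>Hexagonal prisms\<close>

text \<open>Gram-Schmidt in the plane orthogonal to \<open>z\<close>. \<open>D\<close> is the Gram
  determinant of \<open>x\<close> and \<open>y\<close>, the square of base \<open>norm x\<close>
  times height \<open>k\<close>.\<close>

lemma obtain_adapted_frame:
  fixes x y z :: "real^3"
  assumes z: "z \<bullet> z = 1" "x \<bullet> z = 0" "y \<bullet> z = 0"
    and D: "D = (x \<bullet> x) * (y \<bullet> y) - (x \<bullet> y)\<^sup>2" "D > 0"
  obtains n u \<beta> k where "frame n u z" "x = norm x *\<^sub>R n" "y = \<beta> *\<^sub>R n + k *\<^sub>R u"
    "k > 0" "norm x > 0" "norm x * k = sqrt D"
proof -
  have "x \<noteq> 0"
    using D by auto
  define n where "n = x /\<^sub>R norm x"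
  define \<beta> where "\<beta> = y \<bullet> n"
  define r where "r = y - \<beta> *\<^sub>R n"
  have nn: "n \<bullet> n = 1"
    using \<open>x \<noteq> 0\<close> by (simp add: n_def dot_square_norm power2_eq_square)
  then have rn: "n \<bullet> r = 0"
    by (simp add: r_def inner_diff_right \<beta>_def inner_commute)
  have nz: "n \<bullet> z = 0" and rz: "r \<bullet> z = 0"
    using z by (simp_all add: n_def r_def inner_diff_left)
  have "r \<bullet> r = y \<bullet> y - \<beta>\<^sup>2"
    using nn by (simp add: r_def inner_diff_left inner_diff_right \<beta>_def inner_commute power2_eq_square)
  moreover have "norm x * \<beta> = x \<bullet> y"
    using \<open>x \<noteq> 0\<close> by (simp add: \<beta>_def n_def inner_commute)
  ultimately have "(norm x)\<^sup>2 * (r \<bullet> r) = D"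
    by (simp add: D dot_square_norm right_diff_distrib flip: power_mult_distrib)
  then have sq: "(norm x * norm r)\<^sup>2 = D"
    by (simp add: dot_square_norm power_mult_distrib)
  then have "r \<noteq> 0"
    using D by auto
  show ?thesis
  proof
    show "frame n (r /\<^sub>R norm r) z"
      using nn rn nz rz z(1) \<open>r \<noteq> 0\<close> by (simp add: frame_def dot_square_norm power2_eq_square)
    show "x = norm x *\<^sub>R n" "y = \<beta> *\<^sub>R n + norm r *\<^sub>R (r /\<^sub>R norm r)"
      using \<open>x \<noteq> 0\<close> \<open>r \<noteq> 0\<close> by (simp_all add: n_def r_def)
    show "norm x * norm r = sqrt D"
      using sq by (metis norm_ge_zero real_sqrt_abs abs_of_nonneg mult_nonneg_nonneg)
  qed (use \<open>x \<noteq> 0\<close> \<open>r \<noteq> 0\<close> in auto)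
qed

text \<open>The set is the preimage of a rectangle under a triangular linear map of determinant
  \<alpha> k.\<close>

lemma measure_parallelogram:
  fixes \<alpha> \<beta> k p q :: real
  assumes "\<alpha> > 0" "k > 0" "p \<ge> 0" "q \<ge> 0"
  defines "A \<equiv> {Y :: real^2. \<bar>\<alpha> * Y $ 1\<bar> \<le> p \<and> \<bar>\<beta> * Y $ 1 + k * Y $ 2\<bar> \<le> q}"
  shows "A \<in> lmeasurable" "measure lebesgue A = 4 * p * q / (\<alpha> * k)"
proof -
  \<comment> \<open>The inverse of that triangular map.\<close>
  define f :: "real^2 \<Rightarrow> real^2"
    where "f = (\<lambda>Z. vector [Z $ 1 / \<alpha>, (Z $ 2 - \<beta> * (Z $ 1 / \<alpha>)) / k])"
  let ?C = "cbox (vector [- p, - q] :: real^2) (vector [p, q])"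
  have "linear f"
    using assms(1,2) by (intro linearI) (auto simp: f_def vec_eq_iff forall_2 field_simps)
  have "det (matrix f) = 1 / (\<alpha> * k)"
    by (simp add: det_2 matrix_def f_def axis_def)
  have "A = f ` ?C"
  proof (intro equalityI subsetI)
    fix Y assume Y: "Y \<in> A"
    have "Y = f (vector [\<alpha> * Y $ 1, \<beta> * Y $ 1 + k * Y $ 2])"
      using assms(1,2) by (simp add: f_def vec_eq_iff forall_2)
    moreover have "vector [\<alpha> * Y $ 1, \<beta> * Y $ 1 + k * Y $ 2] \<in> ?C"
      using Y by (auto simp: A_def mem_box_cart forall_2 abs_le_iff)
    ultimately show "Y \<in> f ` ?C"
      by blast
  next
    fix Y assume "Y \<in> f ` ?C"
    then show "Y \<in> A"
      using assms(1,2) by (auto simp: A_def f_def mem_box_cart forall_2 abs_le_iff)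
  qed
  then show "A \<in> lmeasurable" "measure lebesgue A = 4 * p * q / (\<alpha> * k)"
    using measurable_linear_image[OF \<open>linear f\<close>, of ?C] measure_linear_image[OF \<open>linear f\<close>, of ?C]
      assms(1,2) measure_cbox_vector_2[OF assms(3,4)] \<open>det (matrix f) = 1 / (\<alpha> * k)\<close>
    by simp_all
qed

section \<open>Upper bounds for facet areas\<close>

lemma planar_area_section_le:
  assumes "frame n u w" "compact K" "aff_dim (K \<inter> {x. n \<bullet> x = h}) = 2"
    and "A \<in> lmeasurable" "\<And>Y. plane_chart (h *\<^sub>R n) u w Y \<in> K \<Longrightarrow> Y \<in> A"
  shows "planar_area (K \<inter> {x. n \<bullet> x = h}) \<le> measure lebesgue A"
proof -
  have "plane_chart (h *\<^sub>R n) u w -` K \<in> sets lebesgue"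
    using planar_area_section(1)[OF assms(1-3)] by (rule fmeasurableD)
  then show ?thesis
    unfolding planar_area_section(2)[OF assms(1-3)]
    using assms(4,5) by (intro measure_mono_fmeasurable) auto
qed

text \<open>Here \<open>x\<close>, \<open>y\<close> and \<open>- (x + y)\<close> form a planar
  superbase and \<open>z\<close> is the vertical direction. The facet normal to \<open>x\<close> has
  height at most 1, and its width is limited by the half-spaces of \<open>- y\<close> and
  \<open>x + y\<close>. The factor \<open>y \<bullet> (x + y)\<close> is the Selling parameter of
  \<open>y\<close> and \<open>- (x + y)\<close>.\<close>

lemma planar_area_lateral_facet_le:
  fixes x y z :: "real^3"
  assumes z: "z \<bullet> z = 1" "x \<bullet> z = 0" "y \<bullet> z = 0"
    and D: "D = (x \<bullet> x) * (y \<bullet> y) - (x \<bullet> y)\<^sup>2" "D > 0"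
    and "compact K" and dim: "aff_dim (K \<inter> {v. x \<bullet> v = x \<bullet> x / 2}) = 2"
    and K: "\<And>v. v \<in> K \<Longrightarrow> - (y \<bullet> y) \<le> 2 * (y \<bullet> v)"
      "\<And>v. v \<in> K \<Longrightarrow> 2 * ((x + y) \<bullet> v) \<le> (x + y) \<bullet> (x + y)"
      "\<And>v. v \<in> K \<Longrightarrow> \<bar>2 * (z \<bullet> v)\<bar> \<le> 1"
    and obtuse: "y \<bullet> (x + y) \<ge> 0"
  shows "planar_area (K \<inter> {v. x \<bullet> v = x \<bullet> x / 2}) \<le> y \<bullet> (x + y) * norm x / sqrt D"
proof -
  obtain n u \<beta> k where fr: "frame n u z" and x: "x = norm x *\<^sub>R n" and y: "y = \<beta> *\<^sub>R n + k *\<^sub>R u"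
    and pos: "k > 0" "norm x > 0" and k: "norm x * k = sqrt D"
    by (rule obtain_adapted_frame[OF z D])
  define \<alpha> where "\<alpha> = norm x"
  have ip: "n \<bullet> n = 1" "u \<bullet> u = 1" "z \<bullet> z = 1" "n \<bullet> u = 0" "n \<bullet> z = 0" "u \<bullet> z = 0"
    "u \<bullet> n = 0" "z \<bullet> n = 0" "z \<bullet> u = 0"
    using fr by (auto simp: frame_def inner_commute)
  have x': "x = \<alpha> *\<^sub>R n" and "\<alpha> > 0"
    using x pos by (simp_all add: \<alpha>_def)
  have slice: "K \<inter> {v. x \<bullet> v = x \<bullet> x / 2} = K \<inter> {v. n \<bullet> v = \<alpha> / 2}"
    using \<open>\<alpha> > 0\<close> by (auto simp: x' ip field_simps)
  \<comment> \<open>Half the width: on the facet, the two half-spaces bound the coordinate along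
    \<open>u\<close> by \<open>- q\<close> and \<open>q\<close>.\<close>
  define q where "q = y \<bullet> (x + y) / (2 * k)"
  have q: "2 * k * q = \<beta>\<^sup>2 + k\<^sup>2 + \<alpha> * \<beta>"
  proof -
    have "2 * k * q = y \<bullet> (x + y)"
      using pos by (simp add: q_def)
    then show ?thesis
      by (simp add: x' y ip inner_add_left inner_add_right power2_eq_square algebra_simps)
  qed
  let ?C = "cbox (vector [- q, - (1/2)] :: real^2) (vector [q, 1/2])"
  have "planar_area (K \<inter> {v. n \<bullet> v = \<alpha> / 2}) \<le> measure lebesgue ?C"
  proof (rule planar_area_section_le[OF fr \<open>compact K\<close>])
    show "aff_dim (K \<inter> {v. n \<bullet> v = \<alpha> / 2}) = 2"
      using dim slice by simp
    fix Y assume Y: "plane_chart ((\<alpha> / 2) *\<^sub>R n) u z Y \<in> K"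
    have eq: "2 * (y \<bullet> plane_chart ((\<alpha> / 2) *\<^sub>R n) u z Y) = \<alpha> * \<beta> + 2 * (k * Y $ 1)"
      "2 * ((x + y) \<bullet> plane_chart ((\<alpha> / 2) *\<^sub>R n) u z Y) = \<alpha>\<^sup>2 + \<alpha> * \<beta> + 2 * (k * Y $ 1)"
      "y \<bullet> y = \<beta>\<^sup>2 + k\<^sup>2" "(x + y) \<bullet> (x + y) = \<alpha>\<^sup>2 + 2 * (\<alpha> * \<beta>) + \<beta>\<^sup>2 + k\<^sup>2"
      by (simp_all add: x' y ip plane_chart_def inner_add_left inner_add_right power2_eq_square
          algebra_simps)
    have "k * (- q) \<le> k * Y $ 1"
      using K(1)[OF Y] q unfolding eq by linarith
    moreover have "k * Y $ 1 \<le> k * q"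
      using K(2)[OF Y] q unfolding eq by linarith
    moreover have "\<bar>2 * Y $ 2\<bar> \<le> 1"
      using K(3)[OF Y] by (simp add: ip plane_chart_def inner_add_right)
    ultimately show "Y \<in> ?C"
      using pos(1) by (simp only: mult_le_cancel_left_pos) (auto simp: mem_box_cart forall_2)
  qed auto
  also have "measure lebesgue ?C = 2 * q"
    using measure_cbox_vector_2[of q "1/2"] obtuse pos(1) by (simp add: q_def)
  also have "2 * q = y \<bullet> (x + y) * norm x / sqrt D"
    using pos by (simp add: q_def flip: k)
  finally show ?thesis
    by (simp only: slice)
qed

text \<open>The strips of \<open>x\<close> and \<open>y\<close> alone confine the section to a
  parallelogram; the corners cut off by \<open>x + y\<close> are kept, as an upper bound
  suffices.\<close>

lemma planar_area_base_facet_le: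
  fixes x y z :: "real^3"
  assumes z: "z \<bullet> z = 1" "x \<bullet> z = 0" "y \<bullet> z = 0"
    and D: "D = (x \<bullet> x) * (y \<bullet> y) - (x \<bullet> y)\<^sup>2" "D > 0"
    and "compact K" and dim: "aff_dim (K \<inter> {v. z \<bullet> v = z \<bullet> z / 2}) = 2"
    and K: "\<And>v. v \<in> K \<Longrightarrow> \<bar>2 * (x \<bullet> v)\<bar> \<le> x \<bullet> x" "\<And>v. v \<in> K \<Longrightarrow> \<bar>2 * (y \<bullet> v)\<bar> \<le> y \<bullet> y"
  shows "planar_area (K \<inter> {v. z \<bullet> v = z \<bullet> z / 2}) \<le> (x \<bullet> x) * (y \<bullet> y) / sqrt D"
proof -
  obtain n u \<beta> k where fr: "frame n u z" and x: "x = norm x *\<^sub>R n" and y: "y = \<beta> *\<^sub>R n + k *\<^sub>R u"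
    and pos: "k > 0" "norm x > 0" and k: "norm x * k = sqrt D"
    by (rule obtain_adapted_frame[OF z D])
  define \<alpha> where "\<alpha> = norm x"
  have ip: "n \<bullet> n = 1" "u \<bullet> u = 1" "z \<bullet> z = 1" "n \<bullet> u = 0" "n \<bullet> z = 0" "u \<bullet> z = 0"
    "u \<bullet> n = 0" "z \<bullet> n = 0" "z \<bullet> u = 0"
    using fr by (auto simp: frame_def inner_commute)
  have x': "x = \<alpha> *\<^sub>R n" and "\<alpha> > 0"
    using x pos by (simp_all add: \<alpha>_def)
  let ?A = "{Y :: real^2. \<bar>\<alpha> * Y $ 1\<bar> \<le> x \<bullet> x / 2 \<and> \<bar>\<beta> * Y $ 1 + k * Y $ 2\<bar> \<le> y \<bullet> y / 2}"
  note A = measure_parallelogram[of \<alpha> k "x \<bullet> x / 2" "y \<bullet> y / 2" \<beta>, OF \<open>\<alpha> > 0\<close> pos(1)]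
  have "planar_area (K \<inter> {v. z \<bullet> v = z \<bullet> z / 2}) \<le> measure lebesgue ?A"
  proof (rule planar_area_section_le[OF frame_rotate[OF frame_rotate[OF fr]] \<open>compact K\<close> dim])
    fix Y assume Y: "plane_chart ((z \<bullet> z / 2) *\<^sub>R z) n u Y \<in> K"
    have eq: "x \<bullet> plane_chart ((z \<bullet> z / 2) *\<^sub>R z) n u Y = \<alpha> * Y $ 1"
      "y \<bullet> plane_chart ((z \<bullet> z / 2) *\<^sub>R z) n u Y = \<beta> * Y $ 1 + k * Y $ 2"
      by (simp_all add: x' y ip plane_chart_def inner_add_left inner_add_right)
    show "Y \<in> ?A"
      using K[OF Y] unfolding eq mem_Collect_eq abs_le_iff by auto
  qed (use A in auto)
  also have "\<dots> = (x \<bullet> x) * (y \<bullet> y) / sqrt D"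
    using A by (simp add: \<alpha>_def k)
  finally show ?thesis .
qed

section \<open>Upper bound for the surface area of an intersection of half-spaces\<close>

lemma sum_set_le_sum_list:
  fixes c :: "'a \<Rightarrow> real"
  assumes "\<And>v. c v \<ge> 0"
  shows "sum c (set vs) \<le> sum_list (map c vs)"
proof (induction vs)
  case (Cons v vs)
  then show ?case
    using assms[of v] by (auto simp: sum.insert_if)
qed simp

text \<open>Every facet is the section of some listed vector, so bounding all listed sections never
  undercounts. It thus does not have to be decided which sections are facets or whether some
  coincide.\<close>

lemma surface_area_le_sum_list:
  fixes vs :: "(real^3) list"
  assumes K: "K = {x. \<forall>v\<in>set vs. v \<bullet> x \<le> v \<bullet> v / 2}" and vs: "0 \<notin> set vs"
    and bound: "\<And>v. v \<in> set vs \<Longrightarrow> aff_dim (K \<inter> {x. v \<bullet> x = v \<bullet> v / 2}) = 2 \<Longrightarrow>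
      planar_area (K \<inter> {x. v \<bullet> x = v \<bullet> v / 2}) \<le> B v"
    and nonneg: "\<And>v. v \<in> set vs \<Longrightarrow> B v \<ge> 0"
  shows "surface_area K \<le> sum_list (map B vs)"
proof -
  define F where "F v = K \<inter> {x. v \<bullet> x = v \<bullet> v / 2}" for v
  define V where "V = {v \<in> set vs. F v facet_of K}"
  have area_nonneg: "planar_area S \<ge> 0" for S
    by (simp add: planar_area_def)
  \<comment> \<open>Sections that are not facets get weight zero, because \<open>B\<close> is known
    to dominate the area only in dimension 2.\<close>
  define c where "c v = (if F v facet_of K then planar_area (F v) else 0)" for v
  have facet: "\<exists>v\<in>set vs. S = F v" if "S facet_of K" for S
    unfolding F_def
    by (rule facet_of_halfspaces[where z = 0, OF finite_set K _ that]) (use vs in force)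
  have "{S. S facet_of K} = F ` V"
    using facet by (auto simp: V_def)
  then have "surface_area K \<le> (\<Sum>v\<in>V. planar_area (F v))"
    using sum_image_le[of V planar_area F] by (simp add: surface_area_def area_nonneg V_def)
  also have "\<dots> = sum c (set vs)"
    by (simp add: V_def c_def sum.inter_filter)
  also have "\<dots> \<le> sum_list (map c vs)"
    by (rule sum_set_le_sum_list) (simp add: c_def area_nonneg)
  also have "\<dots> \<le> sum_list (map B vs)"
  proof (rule sum_list_mono)
    fix v assume v: "v \<in> set vs"
    have "aff_dim K = DIM(real^3)"
      unfolding K by (rule aff_dim_halfspaces[where z = 0]) (use vs in force)+
    then have "F v facet_of K \<Longrightarrow> aff_dim (F v) = 2"
      by (simp add: facet_of_def)
    then show "c v \<le> B v"
      using bound[OF v] nonneg[OF v] by (simp add: c_def F_def)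
  qed
  finally show ?thesis .
qed

section \<open>The Voronoi cell of the hexagonal prism lattice\<close>

text \<open>With \<open>P\<close> and \<open>Q\<close> twice the inner products of a point with the
  first two basis vectors, this is the half-space condition of their combination with coefficients
  \<open>i\<close>, \<open>j\<close>, derived from the conditions of the two vectors and their
  sum.\<close>

lemma two_coordinates_le:
  fixes i j :: int and P Q t :: real
  assumes "t \<ge> 0" "\<bar>P\<bar> \<le> 1 + t" "\<bar>Q\<bar> \<le> 1 + t" "\<bar>P + Q\<bar> \<le> 2"
  shows "of_int i * P + of_int j * Q \<le> (of_int i)\<^sup>2 + (of_int j)\<^sup>2 + t * (of_int (i - j))\<^sup>2"
proof -
  \<comment> \<open>It suffices to compare with \<open>\<bar>i\<bar> + \<bar>j\<bar> + t \<bar>i - j\<bar>\<close>.\<close>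
  have ordered: "a * P + b * Q \<le> a + b + t * (a - b)"
    if "0 \<le> b" "b \<le> a" "P \<le> 1 + t" "P + Q \<le> 2" for a b P Q :: real
  proof -
    \<comment> \<open>Decomposes a P + b Q as b (P + Q) + (a - b) P.\<close>
    have "b * (P + Q) \<le> b * 2" "(a - b) * P \<le> (a - b) * (1 + t)"
      using that by (intro mult_left_mono; simp)+
    then show ?thesis
      by (simp add: algebra_simps)
  qed
  define a b where "a = real_of_int i" and "b = real_of_int j"
  have opposite: "a * P + b * Q \<le> \<bar>a\<bar> + \<bar>b\<bar> + t * (\<bar>a\<bar> + \<bar>b\<bar>)"
  proof -
    have "a * P \<le> \<bar>a\<bar> * (1 + t)" "b * Q \<le> \<bar>b\<bar> * (1 + t)"
      using assms by (metis abs_ge_self abs_ge_zero abs_mult mult_left_mono order_trans)+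
    then show ?thesis
      by (simp add: algebra_simps)
  qed
  have "a * P + b * Q \<le> \<bar>a\<bar> + \<bar>b\<bar> + t * \<bar>a - b\<bar>"
  proof -
    \<comment> \<open>Coefficients of equal sign reduce to \<open>ordered\<close> by swapping or
      negating; for opposite signs |a - b| = |a| + |b|, and the two terms are bounded
      separately.\<close>
    consider "0 \<le> b" "b \<le> a" | "0 \<le> a" "a \<le> b" | "b \<le> 0" "a \<le> b" | "a \<le> 0" "b \<le> a"
      | "\<bar>a - b\<bar> = \<bar>a\<bar> + \<bar>b\<bar>"
      by linarith
    then show ?thesis
    proof cases
      case 1 then show ?thesis using ordered[of b a P Q] assms by (simp add: abs_le_iff)
    next
      case 2 then show ?thesis using ordered[of a b Q P] assms by (simp add: abs_le_iff)
    next
      case 3 then show ?thesis using ordered[of "- b" "- a" "- P" "- Q"] assms by (simp add: abs_le_iff)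
    next
      case 4 then show ?thesis using ordered[of "- a" "- b" "- Q" "- P"] assms by (simp add: abs_le_iff)
    next
      case 5 then show ?thesis using opposite by simp
    qed
  qed
  moreover have sq: "\<bar>real_of_int k\<bar> \<le> (of_int k)\<^sup>2" for k
    using of_int_mult_le_square[of "1/2" 1 "\<bar>k\<bar>"] by simp
  moreover have "t * \<bar>a - b\<bar> \<le> t * (of_int (i - j))\<^sup>2"
    using sq[of "i - j"] \<open>t \<ge> 0\<close> by (intro mult_left_mono) (simp_all add: a_def b_def)
  ultimately show ?thesis
    using sq[of i] sq[of j] unfolding a_def b_def by linarith
qed

text \<open>The condition of a lattice vector splits into a planar part, handled by
  \<open>two_coordinates_le\<close>, and a vertical part, handled by
  \<open>of_int_mult_le_square\<close>.\<close>

lemma voronoi_cell_hexagonal: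
  fixes b :: "real^3^3" and t :: real
  assumes t: "0 \<le> t"
    and ip: "b $ 1 \<bullet> b $ 1 = 1 + t" "b $ 2 \<bullet> b $ 2 = 1 + t" "b $ 1 \<bullet> b $ 2 = - t"
      "b $ 3 \<bullet> b $ 3 = 1" "b $ 1 \<bullet> b $ 3 = 0" "b $ 2 \<bullet> b $ 3 = 0"
  shows "voronoi_cell (lattice_of b) = {x. \<forall>v \<in> set [b $ 1, - b $ 1, b $ 2, - b $ 2,
    b $ 1 + b $ 2, - b $ 1 - b $ 2, b $ 3, - b $ 3]. v \<bullet> x \<le> v \<bullet> v / 2}"
    (is "_ = ?K")
proof (intro equalityI subsetI)
  fix x
  have ip': "b $ 2 \<bullet> b $ 1 = - t" "b $ 3 \<bullet> b $ 1 = 0" "b $ 3 \<bullet> b $ 2 = 0"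
    using ip by (simp_all add: inner_commute)
  have K: "x \<in> ?K \<longleftrightarrow> \<bar>2 * (b $ 1 \<bullet> x)\<bar> \<le> 1 + t \<and> \<bar>2 * (b $ 2 \<bullet> x)\<bar> \<le> 1 + t \<and>
    \<bar>2 * (b $ 1 \<bullet> x) + 2 * (b $ 2 \<bullet> x)\<bar> \<le> 2 \<and> \<bar>2 * (b $ 3 \<bullet> x)\<bar> \<le> 1"
    by (simp add: ip ip' inner_add_left inner_add_right inner_diff_left inner_diff_right abs_le_iff) linarith
  show "x \<in> ?K" if x: "x \<in> voronoi_cell (lattice_of b)"
  proof -
    have *: "2 * (v \<bullet> x) \<le> v \<bullet> v"
      if "v = of_int i *\<^sub>R b $ 1 + of_int j *\<^sub>R b $ 2 + of_int k *\<^sub>R b $ 3" for v i j k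
      using x that unfolding mem_voronoi_cell lattice_of_eq by blast
    have "v \<bullet> x \<le> v \<bullet> v / 2" if "v \<in> set [b $ 1, - b $ 1, b $ 2, - b $ 2,
        b $ 1 + b $ 2, - b $ 1 - b $ 2, b $ 3, - b $ 3]" for v
      using that *[of v 1 0 0] *[of v "-1" 0 0] *[of v 0 1 0] *[of v 0 "-1" 0] *[of v 1 1 0]
        *[of v "-1" "-1" 0] *[of v 0 0 1] *[of v 0 0 "-1"]
      by (simp only: list.set insert_iff empty_iff) (elim disjE; simp)
    then show ?thesis
      by (intro CollectI ballI)
  qed
  show "x \<in> voronoi_cell (lattice_of b)" if "x \<in> ?K"
    unfolding mem_voronoi_cell lattice_of_eq
  proof clarify
    fix i j k :: int
    let ?v = "of_int i *\<^sub>R b $ 1 + of_int j *\<^sub>R b $ 2 + of_int k *\<^sub>R b $ 3"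
    have x: "\<bar>2 * (b $ 1 \<bullet> x)\<bar> \<le> 1 + t" "\<bar>2 * (b $ 2 \<bullet> x)\<bar> \<le> 1 + t"
      "\<bar>2 * (b $ 1 \<bullet> x) + 2 * (b $ 2 \<bullet> x)\<bar> \<le> 2" "\<bar>2 * (b $ 3 \<bullet> x)\<bar> \<le> 1"
      using that unfolding K by blast+
    have "?v \<bullet> ?v = (of_int i)\<^sup>2 + (of_int j)\<^sup>2 + t * (of_int (i - j))\<^sup>2 + (of_int k)\<^sup>2"
      by (simp add: ip ip' inner_add_left inner_add_right power2_eq_square algebra_simps)
    moreover have "2 * (?v \<bullet> x) = of_int i * (2 * (b $ 1 \<bullet> x)) + of_int j * (2 * (b $ 2 \<bullet> x))
        + 2 * (of_int k * (b $ 3 \<bullet> x))"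
      by (simp add: inner_add_left)
    ultimately show "2 * (?v \<bullet> x) \<le> ?v \<bullet> ?v"
      using two_coordinates_le[OF t x(1-3), of i j] of_int_mult_le_square[OF x(4), of k] by linarith
  qed
qed

text \<open>The planar superbase has Selling parameters 1, 1, t. Its two vectors of squared length 1
  + t give four lateral facets, that of squared length 2 gives two, and the bases give the term (1 +
  t)^2.\<close>

lemma surface_area_hexagonal_le:
  fixes b :: "real^3^3" and t :: real
  assumes t: "0 < t" "t < 1"
    and ip: "b $ 1 \<bullet> b $ 1 = 1 + t" "b $ 2 \<bullet> b $ 2 = 1 + t" "b $ 1 \<bullet> b $ 2 = - t"
      "b $ 3 \<bullet> b $ 3 = 1" "b $ 1 \<bullet> b $ 3 = 0" "b $ 2 \<bullet> b $ 3 = 0"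
  shows "surface_area (voronoi_cell (lattice_of b))
    \<le> 2 * ((1 + t)\<^sup>2 + 2 * sqrt (1 + t) + t * sqrt 2) / sqrt (1 + 2 * t)"
proof -
  let ?vs = "[b $ 1, - b $ 1, b $ 2, - b $ 2, b $ 1 + b $ 2, - b $ 1 - b $ 2, b $ 3, - b $ 3]"
  \<comment> \<open>Each pair holds a lateral facet normal and a second vector of the same
    superbase, up to a common sign.\<close>
  let ?pairs = "{(b $ 1, b $ 2), (- b $ 1, - b $ 2), (b $ 2, b $ 1), (- b $ 2, - b $ 1),
    (b $ 1 + b $ 2, - b $ 1), (- b $ 1 - b $ 2, b $ 1)}"
  define K where "K = voronoi_cell (lattice_of b)"
  define D where "D = 1 + 2 * t"
  \<comment> \<open>The inner product with \<open>b $ 3\<close> detects the bases. Squared length 2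
    singles out the sum of the first two vectors, since 1 + t < 2.\<close>
  define B where "B v = (if v \<bullet> b $ 3 \<noteq> 0 then (1 + t)\<^sup>2
      else if v \<bullet> v = 2 then t * sqrt 2 else sqrt (1 + t)) / sqrt D" for v
  have K: "K = {x. \<forall>v \<in> set ?vs. v \<bullet> x \<le> v \<bullet> v / 2}"
    unfolding K_def by (rule voronoi_cell_hexagonal[OF _ ip]) (use t in simp)
  have ip': "b $ 2 \<bullet> b $ 1 = - t" "b $ 3 \<bullet> b $ 1 = 0" "b $ 3 \<bullet> b $ 2 = 0"
    using ip by (simp_all add: inner_commute)
  note bilinear = inner_add_left inner_add_right inner_diff_left inner_diff_right
  have D: "D > 0" "D = (b $ 1 \<bullet> b $ 1) * (b $ 2 \<bullet> b $ 2) - (b $ 1 \<bullet> b $ 2)\<^sup>2"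
    using t by (simp_all add: D_def ip power2_eq_square algebra_simps)
  have mem: "\<bar>2 * (b $ 1 \<bullet> v)\<bar> \<le> 1 + t" "\<bar>2 * (b $ 2 \<bullet> v)\<bar> \<le> 1 + t"
    "\<bar>2 * (b $ 1 \<bullet> v) + 2 * (b $ 2 \<bullet> v)\<bar> \<le> 2" "\<bar>2 * (b $ 3 \<bullet> v)\<bar> \<le> 1" if "v \<in> K" for v
    using that unfolding K by (simp_all add: ip ip' bilinear abs_le_iff; linarith)+
  have "compact K"
  proof -
    obtain n u \<beta> k where fr: "frame n u (b $ 3)" and x: "b $ 1 = norm (b $ 1) *\<^sub>R n"
      and y: "b $ 2 = \<beta> *\<^sub>R n + k *\<^sub>R u" and pos: "k > 0" "norm (b $ 1) > 0"
      by (rule obtain_adapted_frame[OF ip(4-6) D(2,1)])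
    \<comment> \<open>The strip of \<open>b $ 1\<close> bounds the coordinate along \<open>n\<close>
      by \<open>p\<close>; given this, the strip of \<open>b $ 2\<close> bounds that along
      \<open>u\<close>. So \<open>K\<close> lies in a box.\<close>
    define p where "p = (1 + t) / (2 * norm (b $ 1))"
    have "v \<in> brick n u (b $ 3) p ((1 + t + 2 * \<bar>\<beta>\<bar> * p) / (2 * k)) (1/2)" if "v \<in> K" for v
    proof -
      have "norm (b $ 1) * (n \<bullet> v) = b $ 1 \<bullet> v"
        by (subst (2) x) simp
      then have nv: "\<bar>n \<bullet> v\<bar> \<le> p"
        using mem(1)[OF that] pos by (simp add: p_def field_simps abs_le_iff)
      have "2 * k * (u \<bullet> v) = 2 * (b $ 2 \<bullet> v) - 2 * (\<beta> * (n \<bullet> v))"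
        by (simp add: y inner_add_left)
      moreover have "\<bar>\<beta> * (n \<bullet> v)\<bar> \<le> \<bar>\<beta>\<bar> * p"
        using nv by (simp add: abs_mult mult_left_mono)
      ultimately have "\<bar>2 * k * (u \<bullet> v)\<bar> \<le> 1 + t + 2 * \<bar>\<beta>\<bar> * p"
        using mem(2)[OF that] by linarith
      then have "\<bar>u \<bullet> v\<bar> \<le> (1 + t + 2 * \<bar>\<beta>\<bar> * p) / (2 * k)"
        using pos by (simp add: abs_mult field_simps)
      then show ?thesis
        using nv mem(4)[OF that] by (simp add: brick_def)
    qed
    then have "bounded K"
      using bounded_brick[OF fr] bounded_subset by blast
    moreover have "closed K"
      unfolding K halfspaces_eq_INT by (intro closed_INT ballI closed_halfspace_le)
    ultimately show ?thesis
      by (simp add: compact_eq_bounded_closed)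
  qed
  have lateral: "planar_area (K \<inter> {w. x \<bullet> w = x \<bullet> x / 2}) \<le> B x"
    if dim: "aff_dim (K \<inter> {w. x \<bullet> w = x \<bullet> x / 2}) = 2"
      and xy: "(x, y) \<in> ?pairs" for x y
  proof -
    have "planar_area (K \<inter> {w. x \<bullet> w = x \<bullet> x / 2}) \<le> y \<bullet> (x + y) * norm x / sqrt D"
    proof (rule planar_area_lateral_facet_le[OF ip(4) _ _ _ D(1) \<open>compact K\<close> dim])
      show "x \<bullet> b $ 3 = 0" "y \<bullet> b $ 3 = 0" "y \<bullet> (x + y) \<ge> 0"
        using xy t by (auto simp: ip ip' bilinear)
      show "D = (x \<bullet> x) * (y \<bullet> y) - (x \<bullet> y)\<^sup>2"
        using xy by (auto simp: ip ip' bilinear) (simp_all add: D_def power2_eq_square algebra_simps)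
      fix v assume "v \<in> K"
      note v = mem[OF this]
      show "- (y \<bullet> y) \<le> 2 * (y \<bullet> v)"
        using xy v by (auto simp: ip ip' bilinear)
      show "2 * ((x + y) \<bullet> v) \<le> (x + y) \<bullet> (x + y)"
        using xy v by (auto simp: ip ip' bilinear)
      show "\<bar>2 * (b $ 3 \<bullet> v)\<bar> \<le> 1"
        by (rule v)
    qed
    also have "y \<bullet> (x + y) * norm x / sqrt D = B x"
      using xy t by (auto simp: B_def norm_eq_sqrt_inner ip ip' bilinear)
    finally show ?thesis .
  qed
  have base: "planar_area (K \<inter> {w. x \<bullet> w = x \<bullet> x / 2}) \<le> B x"
    if dim: "aff_dim (K \<inter> {w. x \<bullet> w = x \<bullet> x / 2}) = 2" and x: "x \<in> {b $ 3, - b $ 3}" for x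
  proof -
    have "planar_area (K \<inter> {w. x \<bullet> w = x \<bullet> x / 2})
        \<le> (b $ 1 \<bullet> b $ 1) * (b $ 2 \<bullet> b $ 2) / sqrt D"
      using x mem
      by (intro planar_area_base_facet_le[OF _ _ _ D(2,1) \<open>compact K\<close> dim]) (auto simp: ip)
    also have "\<dots> = B x"
      using x by (auto simp: B_def ip power2_eq_square)
    finally show ?thesis .
  qed
  have "surface_area K \<le> sum_list (map B ?vs)"
  proof (rule surface_area_le_sum_list[OF K])
    have "\<forall>v \<in> set ?vs. v \<bullet> v \<noteq> 0"
      using t by (simp add: ip ip' bilinear del: inner_eq_zero_iff)
    then show "0 \<notin> set ?vs"
      by (metis inner_zero_left)
    show "B v \<ge> 0" if "v \<in> set ?vs" for v
      using t by (simp add: B_def D_def)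
    show "planar_area (K \<inter> {x. v \<bullet> x = v \<bullet> v / 2}) \<le> B v"
      if v: "v \<in> set ?vs" and dim: "aff_dim (K \<inter> {x. v \<bullet> x = v \<bullet> v / 2}) = 2" for v
    proof -
      have "v \<in> {b $ 3, - b $ 3} \<union> fst ` ?pairs"
        using v by simp
      then show ?thesis
        using lateral[OF dim] base[OF dim] by (elim UnE imageE) (metis prod.collapse)+
    qed
  qed
  also have "\<dots> = 2 * ((1 + t)\<^sup>2 + 2 * sqrt (1 + t) + t * sqrt 2) / sqrt D"
    using t by (simp add: B_def ip ip' bilinear add_divide_distrib)
  finally show ?thesis
    unfolding K_def D_def .
qed

section \<open>Failure of stationarity at the cubic lattice\<close>

text \<open>An explicit differentiable majorant of the quotient for 0 < t < 1, which takes the value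
  6 of the cube at t = 0.\<close>

definition hexagonal_bound :: "real \<Rightarrow> real" where
  "hexagonal_bound t = 2 * ((1 + t)\<^sup>2 + 2 * sqrt (1 + t) + t * sqrt 2) / sqrt (1 + 2 * t)
     / (1 + 2 * t) powr (1 / 3)"

lemma isoperimetric_quotient_hexagonal_le:
  assumes t: "0 < t" "t < 1"
  shows "isoperimetric_quotient (\<chi> j. if j = 4 then t else rho_SC $ j) \<le> hexagonal_bound t"
proof -
  define \<rho> where "\<rho> = (\<chi> j. if j = 4 then t else rho_SC $ j)"
  have \<rho>: "\<rho> $ 1 = 1" "\<rho> $ 2 = 1" "\<rho> $ 3 = 1" "\<rho> $ 4 = t" "\<rho> $ 5 = 0" "\<rho> $ 6 = 0"
    by (simp_all add: \<rho>_def rho_SC_nth)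
  \<comment> \<open>The first two basis vectors are mirror images in the first axis. Their sum has
    squared length 2, which gives the coordinate \<open>sqrt (1/2)\<close>; their inner product - t
    then fixes \<open>s\<close>.\<close>
  define s where "s = sqrt ((1 + 2 * t) / 2)"
  have s: "s * s = (1 + 2 * t) / 2"
    using t by (simp add: s_def)
  define b :: "real^3^3" where
    "b = vector [vector [sqrt (1/2), s, 0], vector [sqrt (1/2), - s, 0], vector [0, 0, 1]]"
  have "gram b = selling_matrix \<rho>"
    using s by (simp add: vec_eq_iff forall_3 gram_nth b_def inner_vec_def sum_3 selling_matrix_nth \<rho>
        real_sqrt_mult_self flip: real_sqrt_mult)
  note gram_selling_basis[OF this]
  then have g: "selling_basis \<rho> $ i \<bullet> selling_basis \<rho> $ j = selling_matrix \<rho> $ i $ j" for i j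
    by (metis gram_nth)
  have "cell_area \<rho> \<le> 2 * ((1 + t)\<^sup>2 + 2 * sqrt (1 + t) + t * sqrt 2) / sqrt (1 + 2 * t)"
    unfolding cell_area_def
    by (rule surface_area_hexagonal_le[OF t]) (simp_all add: g selling_matrix_nth \<rho>)
  moreover have "det (selling_matrix \<rho>) = 1 + 2 * t"
    by (simp add: det_3 selling_matrix_nth \<rho> algebra_simps)
  ultimately show ?thesis
    unfolding \<rho>_def[symmetric] isoperimetric_quotient_def hexagonal_bound_def
    by (simp only:) (rule divide_right_mono, simp_all)
qed

text \<open>At 0 the numerator has value 6 and slope 6 + 2 sqrt 2, and the denominator (1 + 2
  t)^(5/6) contributes 6 times -5/3, that is -10.\<close>

lemma DERIV_hexagonal_bound: "(hexagonal_bound has_real_derivative 2 * sqrt 2 - 4) (at 0)"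
  unfolding hexagonal_bound_def [abs_def]
  by (rule derivative_eq_intros refl | simp)+

text \<open>If the one-sided derivative of the quotient were 0, the majorant minus the quotient
  would start at 0 with negative slope and become negative.\<close>

lemma not_stationary_rho_SC: "\<not> stationary_on_orthant isoperimetric_quotient rho_SC"
proof
  define q where "q t = isoperimetric_quotient (\<chi> j. if j = 4 then t else rho_SC $ j)" for t
  assume "stationary_on_orthant isoperimetric_quotient rho_SC"
  then have "(q has_real_derivative 0) (at (rho_SC $ 4) within {0..})"
    unfolding stationary_on_orthant_def q_def by blast
  then have "((\<lambda>t. hexagonal_bound t - q t) has_real_derivative 2 * sqrt 2 - 4 - 0) (at 0 within {0..})"
    by (intro DERIV_diff has_field_derivative_at_within[OF DERIV_hexagonal_bound])
      (simp add: rho_SC_nth)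
  moreover have "2 * sqrt 2 - 4 - 0 < (0::real)"
    using real_sqrt_less_mono[of 2 4] by simp
  ultimately obtain d where d: "d > 0"
    "\<And>h. h > 0 \<Longrightarrow> 0 + h \<in> {0..} \<Longrightarrow> h < d \<Longrightarrow> hexagonal_bound (0 + h) - q (0 + h) < hexagonal_bound 0 - q 0"
    using has_real_derivative_neg_dec_right by blast
  \<comment> \<open>Below \<open>d\<close> for the decrease, and below 1 for the majorant to
    apply.\<close>
  define h where "h = min d 1 / 2"
  have h: "0 < h" "h < d" "h < 1"
    using d(1) by (auto simp: h_def)
  have "(\<chi> j. if j = 4 then 0 else rho_SC $ j) = rho_SC"
    by (simp add: vec_eq_iff rho_SC_nth)
  then have "q 0 = 6"
    by (simp add: q_def isoperimetric_quotient_rho_SC)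
  then have "hexagonal_bound h < q h"
    using d(2)[of h] h by (simp add: hexagonal_bound_def)
  then show False
    using isoperimetric_quotient_hexagonal_le[OF h(1,3)] by (simp add: q_def)
qed

theorem theorem3p4:
  "\<not> stationary_on_orthant isoperimetric_quotient rho_SC \<and>
   strict_local_minimiser_on isoperimetric_quotient
     {\<rho> \<in> Sigma_box. det (selling_matrix \<rho>) = det (selling_matrix rho_SC)} rho_SC"
proof
  show "strict_local_minimiser_on isoperimetric_quotient
     {\<rho> \<in> Sigma_box. det (selling_matrix \<rho>) = det (selling_matrix rho_SC)} rho_SC"
    unfolding strict_local_minimiser_on_def det_selling_matrix_rho_SC
    using rho_SC_in_Sigma_box det_selling_matrix_rho_SC rho_SC_strict_minimum
    \<comment> \<open>The minimum is global on this set, so the radius is arbitrary.\<close>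
    by (auto intro!: exI[of _ 1])
qed (rule not_stationary_rho_SC)

end
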